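(* Let $M^{>0}=\{(x^1,x^2,x^3,x^4,x^5,x^6)\in\mathbb R^6 \mid x^2>0\}$, let $f:\mathbb R^{>0}\to\mathbb R^{>0}$ be a smooth function satisfying $f(t)=1$ for $t\in\,]0,1]$ and $f(t)=t$ for $t\ge2$, and let $$\omega^f=dx^{135}-dx^{146}-dx^{236}+f(x^2)\,dx^{245}.$$ Then $(M^{>0},\omega^f)$ is multisymplectic and of constant linear type, but its group of multisymplectic diffeomorphisms does not act transitively on $M^{>0}$.
   Context: Here $x^1,\dots,x^6$ are coordinates (upper indices, not powers) and $dx^{ijk}=dx^i\wedge dx^j\wedge dx^k$. A manifold $M$ with a closed $(k+1)$-form $\omega$, $k\ge1$, is multisymplectic if $T_pM\to\Lambda^kT_p^*M$, $v\mapsto\iota_v\omega_p$, is injective for all $p$. Constant linear type: for all $p,q\in M$ there is a linear isomorphism $L:T_pM\to T_qM$ with $L^*\omega_q=\omega_p$. The group of multisymplectic diffeomorphisms is the group of all diffeomorphisms $\varphi:M\to M$ with $\varphi^*\omega=\omega$. *)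

theory Defs
  imports "HOL-Analysis.Analysis"
begin

section \<open>Smooth maps on open sets\<close>

text \<open>For open \<open>S\<close>: \<open>f\<close> is \<open>n\<close> times differentiable with continuous \<open>n\<close>-th derivatives.
  Only the values of \<open>f\<close> on \<open>S\<close> matter.\<close>

primrec times_differentiable_on ::
  "nat \<Rightarrow> ('a::euclidean_space \<Rightarrow> 'b::real_normed_vector) \<Rightarrow> 'a set \<Rightarrow> bool" where
  "times_differentiable_on 0 f S \<longleftrightarrow> continuous_on S f"
| "times_differentiable_on (Suc n) f S \<longleftrightarrow>
     (\<forall>x\<in>S. f differentiable (at x)) \<and>
     (\<forall>v. times_differentiable_on n (\<lambda>x. frechet_derivative f (at x) v) S)"

definition smooth_on :: "'a set \<Rightarrow> ('a::euclidean_space \<Rightarrow> 'b::real_normed_vector) \<Rightarrow> bool" where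
  "smooth_on S f \<longleftrightarrow> (\<forall>n. times_differentiable_on n f S)"


section \<open>Alternating forms on a vector space\<close>

text \<open>A \<open>k\<close>-form takes the list of its \<open>k\<close> arguments. By convention it is \<open>0\<close> on
  lists of any other length, so that two \<open>k\<close>-forms are equal iff they are equal as functions.\<close>

definition alt_forms :: "nat \<Rightarrow> ('a::real_vector list \<Rightarrow> real) set" where
  "alt_forms k = {\<alpha>.
     (\<forall>vs i. length vs = k \<longrightarrow> i < k \<longrightarrow> linear (\<lambda>v. \<alpha> (vs[i := v]))) \<and>
     (\<forall>vs. length vs = k \<longrightarrow> \<not> distinct vs \<longrightarrow> \<alpha> vs = 0) \<and>
     (\<forall>vs. length vs \<noteq> k \<longrightarrow> \<alpha> vs = 0)}"

definition interior_product :: "'a \<Rightarrow> ('a list \<Rightarrow> real) \<Rightarrow> 'a list \<Rightarrow> real" where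
  "interior_product v \<alpha> = (\<lambda>vs. \<alpha> (v # vs))"

definition pullback_linear :: "('a \<Rightarrow> 'b) \<Rightarrow> ('b list \<Rightarrow> real) \<Rightarrow> 'a list \<Rightarrow> real" where
  "pullback_linear L \<alpha> = (\<lambda>vs. \<alpha> (map L vs))"

text \<open>Wedge product of a \<open>p\<close>-form and a \<open>q\<close>-form, normalised such that the wedge product of
  covectors \<open>\<alpha>\<^sub>1, \<dots>, \<alpha>\<^sub>k\<close> is \<open>det (\<alpha>\<^sub>i (v\<^sub>j))\<close>.\<close>

definition wedge ::
  "nat \<Rightarrow> nat \<Rightarrow> ('a list \<Rightarrow> real) \<Rightarrow> ('a list \<Rightarrow> real) \<Rightarrow> 'a list \<Rightarrow> real" where
  "wedge p q \<alpha> \<beta> = (\<lambda>vs. if length vs = p + q then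
     (\<Sum>\<sigma> | \<sigma> permutes {..<p + q}.
        of_int (sign \<sigma>) * \<alpha> (take p (permute_list \<sigma> vs)) * \<beta> (drop p (permute_list \<sigma> vs)))
       / (fact p * fact q)
     else 0)"


section \<open>Differential forms on open subsets of a Euclidean space\<close>

text \<open>All manifolds here are open subsets \<open>M\<close> of a Euclidean space \<open>'a\<close>, with every tangent
  space identified with \<open>'a\<close>. Values of forms outside \<open>M\<close> are irrelevant.\<close>

definition differential_form ::
  "'a::euclidean_space set \<Rightarrow> nat \<Rightarrow> ('a \<Rightarrow> 'a list \<Rightarrow> real) \<Rightarrow> bool" where
  "differential_form M k \<omega> \<longleftrightarrow>
     (\<forall>x\<in>M. \<omega> x \<in> alt_forms k) \<and> (\<forall>vs. smooth_on M (\<lambda>x. \<omega> x vs))"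

text \<open>The invariant formula for the exterior derivative, evaluated on constant vector fields
  (whose brackets vanish).\<close>

definition exterior_derivative ::
  "('a::euclidean_space \<Rightarrow> 'a list \<Rightarrow> real) \<Rightarrow> 'a \<Rightarrow> 'a list \<Rightarrow> real" where
  "exterior_derivative \<omega> x = (\<lambda>vs. \<Sum>i<length vs.
     (-1) ^ i * frechet_derivative (\<lambda>y. \<omega> y (take i vs @ drop (Suc i) vs)) (at x) (vs ! i))"

definition closed_form ::
  "'a::euclidean_space set \<Rightarrow> ('a \<Rightarrow> 'a list \<Rightarrow> real) \<Rightarrow> bool" where
  "closed_form M \<omega> \<longleftrightarrow> (\<forall>x\<in>M. exterior_derivative \<omega> x = (\<lambda>_. 0))"

definition pullback ::
  "('a::euclidean_space \<Rightarrow> 'b::euclidean_space) \<Rightarrow> ('b \<Rightarrow> 'b list \<Rightarrow> real) \<Rightarrow> 'a \<Rightarrow> 'a list \<Rightarrow> real" where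
  "pullback \<phi> \<omega> x = pullback_linear (frechet_derivative \<phi> (at x)) (\<omega> (\<phi> x))"


section \<open>Multisymplectic manifolds\<close>

text \<open>The degree of \<open>\<omega>\<close> is \<open>k + 1\<close>.\<close>

definition multisymplectic ::
  "'a::euclidean_space set \<Rightarrow> nat \<Rightarrow> ('a \<Rightarrow> 'a list \<Rightarrow> real) \<Rightarrow> bool" where
  "multisymplectic M k \<omega> \<longleftrightarrow>
     open M \<and> k \<ge> 1 \<and> differential_form M (k + 1) \<omega> \<and> closed_form M \<omega> \<and>
     (\<forall>p\<in>M. inj (\<lambda>v. interior_product v (\<omega> p)))"

definition constant_linear_type ::
  "'a::euclidean_space set \<Rightarrow> ('a \<Rightarrow> 'a list \<Rightarrow> real) \<Rightarrow> bool" where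
  "constant_linear_type M \<omega> \<longleftrightarrow>
     (\<forall>p\<in>M. \<forall>q\<in>M. \<exists>L. linear L \<and> bij L \<and> pullback_linear L (\<omega> q) = \<omega> p)"

text \<open>Maps \<open>M \<rightarrow> M\<close> are represented by functions that are \<open>undefined\<close> outside \<open>M\<close>.\<close>

definition diffeomorphisms :: "'a::euclidean_space set \<Rightarrow> ('a \<Rightarrow> 'a) set" where
  "diffeomorphisms M = {\<phi>. \<phi> \<in> extensional M \<and> bij_betw \<phi> M M \<and>
     smooth_on M \<phi> \<and> smooth_on M (inv_into M \<phi>)}"

definition multisymplectic_diffeomorphisms ::
  "'a::euclidean_space set \<Rightarrow> ('a \<Rightarrow> 'a list \<Rightarrow> real) \<Rightarrow> ('a \<Rightarrow> 'a) set" where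
  "multisymplectic_diffeomorphisms M \<omega> =
     {\<phi> \<in> diffeomorphisms M. \<forall>x\<in>M. pullback \<phi> \<omega> x = \<omega> x}"

definition acts_transitively_on :: "('a \<Rightarrow> 'a) set \<Rightarrow> 'a set \<Rightarrow> bool" where
  "acts_transitively_on G M \<longleftrightarrow> (\<forall>p\<in>M. \<forall>q\<in>M. \<exists>\<phi>\<in>G. \<phi> p = q)"


section \<open>The forms \<open>\<omega>\<^sup>f\<close> on a half space of \<open>\<real>\<^sup>6\<close>\<close>

text \<open>The coordinates \<open>x\<^sup>1, \<dots>, x\<^sup>6\<close> are \<open>x $ 1, \<dots>, x $ 6\<close>; the index type \<open>6\<close> is cyclic,
  so \<open>6 = 0\<close> there, but the six indices are distinct.\<close>

definition dx :: "6 \<Rightarrow> (real ^ 6) list \<Rightarrow> real" where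
  "dx i = (\<lambda>vs. if length vs = 1 then hd vs $ i else 0)"

definition dx3 :: "6 \<Rightarrow> 6 \<Rightarrow> 6 \<Rightarrow> (real ^ 6) list \<Rightarrow> real" where
  "dx3 i j k = wedge 1 2 (dx i) (wedge 1 1 (dx j) (dx k))"

definition M_pos :: "(real ^ 6) set" where
  "M_pos = {x. x $ 2 > 0}"

definition omega_f :: "(real \<Rightarrow> real) \<Rightarrow> real ^ 6 \<Rightarrow> (real ^ 6) list \<Rightarrow> real" where
  "omega_f f x = (\<lambda>vs. dx3 1 3 5 vs - dx3 1 4 6 vs - dx3 2 3 6 vs + f (x $ 2) * dx3 2 4 5 vs)"

end

(* With g = sqrt f and the coframe e = (dx1, g dx2, dx3, g dx4, dx5, dx6/g), the form is
   1/2 (e1+e2)(e3+e4)(e5-e6) + 1/2 (e1-e2)(e3-e4)(e5+e6).  Rescaling coordinates shows that its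
   linear type does not depend on f.  The vectors v whose contraction with the form is decomposable
   are those in E or in F, where E is the common kernel of e1+e2, e3+e4, e5-e6 and F that of
   e1-e2, e3-e4, e5+e6; so a multisymplectic diffeomorphism preserves the union of E and F.
   Where x2 <= 1, E and F are constant, hence involutive.  On E, however, d(e3+e4) = g' dx2 dx4 is
   nonzero wherever g' is, in particular where x2 >= 2.  Hence no point with x2 < 1 can be mapped to
   a point with x2 > 2. *)

theory Submission
  imports Defs
begin

section \<open>Smooth maps\<close>

text \<open>The derivative at a point of an open set depends only on values inside the set. So
  \<open>f\<close> and \<open>g\<close> have the same derivatives on \<open>S\<close>, and the
  induction passes to these.\<close>

lemma times_differentiable_on_cong:
  assumes "open S" "\<And>x. x \<in> S \<Longrightarrow> f x = g x" "times_differentiable_on n f S"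
  shows "times_differentiable_on n g S"
  using assms(2,3)
proof (induction n arbitrary: f g)
  case 0
  then show ?case by (simp cong: continuous_on_cong)
next
  case (Suc n)
  have ev: "\<forall>\<^sub>F y in nhds x. f y = g y" if "x \<in> S" for x
    using that assms(1) Suc.prems(1) by (auto simp: eventually_nhds)
  have der: "(g has_derivative frechet_derivative f (at x)) (at x)" if "x \<in> S" for x
  proof (rule has_derivative_transform_within_open[OF _ assms(1) that Suc.prems(1)])
    show "(f has_derivative frechet_derivative f (at x)) (at x)"
      using Suc.prems(2) that by (simp flip: frechet_derivative_works)
  qed
  have "frechet_derivative g (at x) = frechet_derivative f (at x)" if "x \<in> S" for x
    using frechet_derivative_at[OF der[OF that]] by simp
  moreover have "g differentiable (at x)" if "x \<in> S" for x
    using der[OF that] by (auto simp: differentiable_def)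
  ultimately show ?case
    using Suc.prems(2) Suc.IH[of "\<lambda>x. frechet_derivative f (at x) v"
        "\<lambda>x. frechet_derivative g (at x) v" for v] by auto
qed

section \<open>Functions of a single coordinate\<close>

lemma has_derivative_affine_comp_component:
  fixes f :: "real \<Rightarrow> real" and x :: "real ^ 'n"
  assumes "f differentiable (at (x $ i))"
  shows "((\<lambda>y. a + c * f (y $ i)) has_derivative
    (\<lambda>v. c * v $ i * frechet_derivative f (at (x $ i)) 1)) (at x)"
proof -
  have f': "(f has_derivative frechet_derivative f (at (x $ i))) (at (x $ i))"
    using assms frechet_derivative_works by blast
  have "((\<lambda>y. f (y $ i)) has_derivative (\<lambda>v. frechet_derivative f (at (x $ i)) (v $ i))) (at x)"
  proof (rule has_derivative_compose[where g = f and f = "\<lambda>y. y $ i" and f' = "\<lambda>v. v $ i"])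
    show "((\<lambda>y. y $ i) has_derivative (\<lambda>v. v $ i)) (at x)"
      by (rule bounded_linear_imp_has_derivative[OF bounded_linear_vec_nth])
  qed (rule f')
  from has_derivative_add[OF has_derivative_const has_derivative_mult_right[OF this]]
  have "((\<lambda>y. a + c * f (y $ i)) has_derivative
      (\<lambda>v. c * frechet_derivative f (at (x $ i)) (v $ i))) (at x)" by simp
  moreover have "c * frechet_derivative f (at (x $ i)) (v $ i) =
      c * v $ i * frechet_derivative f (at (x $ i)) 1" for v
    using linear_cmul[OF has_derivative_linear[OF f'], of "v $ i" 1]
    by (simp only: real_scaleR_def mult_1_right mult.assoc)
  ultimately show ?thesis by (simp only:)
qed

text \<open>On fixed arguments \<open>omega_f\<close> has the shape
  \<open>a + c * f (x $ i)\<close>, which differentiation preserves: in direction \<open>v\<close>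
  it replaces \<open>a\<close> by 0, \<open>c\<close> by \<open>c * v $ i\<close> and
  \<open>f\<close> by its derivative. Hence the induction generalises over all three.\<close>

lemma times_differentiable_on_affine_comp_component:
  fixes f :: "real \<Rightarrow> real" and S :: "(real ^ 'n) set"
  assumes "open S" "(\<lambda>x. x $ i) ` S \<subseteq> T" "times_differentiable_on n f T"
  shows "times_differentiable_on n (\<lambda>x. a + c * f (x $ i)) S"
  using assms(3)
proof (induction n arbitrary: f a c)
  case 0
  have "continuous_on S (\<lambda>x. f (x $ i))"
    using 0 assms(2) continuous_on_compose2[of T f S "\<lambda>x. x $ i"]
    by (simp add: continuous_on_component)
  then show ?case by (auto intro!: continuous_intros)
next
  case (Suc n)
  have der: "((\<lambda>y. a + c * f (y $ i)) has_derivative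
    (\<lambda>v. c * v $ i * frechet_derivative f (at (x $ i)) 1)) (at x)" if "x \<in> S" for x
    using Suc.prems that assms(2) by (intro has_derivative_affine_comp_component) auto
  have "times_differentiable_on n (\<lambda>x. frechet_derivative (\<lambda>y. a + c * f (y $ i)) (at x) v) S" for v
  proof (rule times_differentiable_on_cong[OF assms(1)])
    show "times_differentiable_on n
        (\<lambda>x. 0 + (c * v $ i) * (\<lambda>t. frechet_derivative f (at t) 1) (x $ i)) S"
      using Suc.prems by (intro Suc.IH[of "\<lambda>t. frechet_derivative f (at t) 1"]) simp
    fix x assume "x \<in> S"
    from frechet_derivative_at[OF der[OF this], symmetric]
    show "0 + (c * v $ i) * frechet_derivative f (at (x $ i)) 1 =
        frechet_derivative (\<lambda>y. a + c * f (y $ i)) (at x) v"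
      by (simp only: add_0)
  qed
  moreover have "(\<lambda>x. a + c * f (x $ i)) differentiable (at x)" if "x \<in> S" for x
    using der[OF that] unfolding differentiable_def by blast
  ultimately show ?case by simp
qed

section \<open>Symmetry of second derivatives\<close>

text \<open>The mean value theorem is applied twice, first along \<open>u\<close> and then along
  \<open>v\<close>. The bound on \<open>h\<close> keeps the whole parallelogram inside the
  ball.\<close>

lemma second_difference_mean_value:
  fixes F :: "'a::real_normed_vector \<Rightarrow> real"
  assumes Fu: "\<And>x. x \<in> ball p r \<Longrightarrow> (F has_derivative F' x) (at x)"
    and Fvu: "\<And>x. x \<in> ball p r \<Longrightarrow> ((\<lambda>y. F' y u) has_derivative F'' x) (at x)"
    and h: "0 < h" "h * (norm u + norm v) < r"
  shows "\<exists>\<xi>\<in>ball p r. F (p + h *\<^sub>R u + h *\<^sub>R v) - F (p + h *\<^sub>R u) - F (p + h *\<^sub>R v) + F p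
    = h\<^sup>2 * F'' \<xi> v"
proof -
  have mem: "p + s *\<^sub>R u + t *\<^sub>R v \<in> ball p r" if "0 \<le> s" "s \<le> h" "0 \<le> t" "t \<le> h" for s t
  proof -
    have "norm (s *\<^sub>R u + t *\<^sub>R v) \<le> s * norm u + t * norm v"
      using that norm_triangle_ineq[of "s *\<^sub>R u" "t *\<^sub>R v"] by simp
    also have "\<dots> \<le> h * norm u + h * norm v"
      using that by (intro add_mono mult_right_mono) auto
    finally have "norm (s *\<^sub>R u + t *\<^sub>R v) < r" using h by (simp add: distrib_left)
    then show ?thesis
      by (metis add.assoc add_diff_cancel_left' dist_commute dist_norm mem_ball)
  qed
  have dF: "((\<lambda>s. F (p + s *\<^sub>R u + t *\<^sub>R v)) has_real_derivative F' (p + s *\<^sub>R u + t *\<^sub>R v) u) (at s)"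
    if "0 \<le> s" "s \<le> h" "0 \<le> t" "t \<le> h" for s t
  proof -
    note F = Fu[OF mem[OF that]]
    have "((\<lambda>s. F (p + s *\<^sub>R u + t *\<^sub>R v)) has_derivative
        (\<lambda>k. F' (p + s *\<^sub>R u + t *\<^sub>R v) (k *\<^sub>R u))) (at s)"
      by (rule has_derivative_compose[where g = F and f = "\<lambda>s. p + s *\<^sub>R u + t *\<^sub>R v"
            and f' = "\<lambda>k. k *\<^sub>R u", OF _ F]) (auto intro!: derivative_eq_intros)
    then show ?thesis
      unfolding has_field_derivative_def
      by (simp add: linear_cmul[OF has_derivative_linear[OF F]] mult_commute_abs)
  qed
  have dF': "((\<lambda>t. F' (p + s *\<^sub>R u + t *\<^sub>R v) u) has_real_derivative F'' (p + s *\<^sub>R u + t *\<^sub>R v) v) (at t)"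
    if "0 \<le> s" "s \<le> h" "0 \<le> t" "t \<le> h" for s t
  proof -
    note F = Fvu[OF mem[OF that]]
    have "((\<lambda>t. F' (p + s *\<^sub>R u + t *\<^sub>R v) u) has_derivative
        (\<lambda>k. F'' (p + s *\<^sub>R u + t *\<^sub>R v) (k *\<^sub>R v))) (at t)"
      by (rule has_derivative_compose[where g = "\<lambda>x. F' x u" and f = "\<lambda>t. p + s *\<^sub>R u + t *\<^sub>R v"
            and f' = "\<lambda>k. k *\<^sub>R v", OF _ F]) (auto intro!: derivative_eq_intros)
    then show ?thesis
      unfolding has_field_derivative_def
      by (simp add: linear_cmul[OF has_derivative_linear[OF F]] mult_commute_abs)
  qed
  \<comment> \<open>Difference in direction \<open>v\<close>, as a function of the position along
    \<open>u\<close>. Writing \<open>0 *\<^sub>R v\<close> lets the second mean value step run from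
    \<open>t = 0\<close> to \<open>t = h\<close>.\<close>
  define K where "K s = F (p + s *\<^sub>R u + h *\<^sub>R v) - F (p + s *\<^sub>R u + 0 *\<^sub>R v)" for s
  have "\<exists>s>0. s < h \<and> K h - K 0 =
      (h - 0) * (F' (p + s *\<^sub>R u + h *\<^sub>R v) u - F' (p + s *\<^sub>R u + 0 *\<^sub>R v) u)"
    unfolding K_def using h by (intro MVT2 DERIV_diff dF) auto
  then obtain s where s: "0 < s" "s < h"
    "K h - K 0 = h * (F' (p + s *\<^sub>R u + h *\<^sub>R v) u - F' (p + s *\<^sub>R u + 0 *\<^sub>R v) u)" by auto
  have "\<exists>t>0. t < h \<and> F' (p + s *\<^sub>R u + h *\<^sub>R v) u - F' (p + s *\<^sub>R u + 0 *\<^sub>R v) u =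
      (h - 0) * F'' (p + s *\<^sub>R u + t *\<^sub>R v) v"
    using h s by (intro MVT2 dF') auto
  then obtain t where t: "0 < t" "t < h"
    "F' (p + s *\<^sub>R u + h *\<^sub>R v) u - F' (p + s *\<^sub>R u + 0 *\<^sub>R v) u =
      h * F'' (p + s *\<^sub>R u + t *\<^sub>R v) v" by auto
  show ?thesis
  proof (rule bexI)
    show "p + s *\<^sub>R u + t *\<^sub>R v \<in> ball p r" using s t by (intro mem) auto
    show "F (p + h *\<^sub>R u + h *\<^sub>R v) - F (p + h *\<^sub>R u) - F (p + h *\<^sub>R v) + F p
        = h\<^sup>2 * F'' (p + s *\<^sub>R u + t *\<^sub>R v) v"
      using s(3) t(3) by (simp add: K_def power2_eq_square)
  qed
qed

text \<open>The second difference over a small parallelogram is symmetric in \<open>u\<close> and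
  \<open>v\<close>, so the two mixed derivatives agree at suitable points near \<open>p\<close>;
  continuity at \<open>p\<close> carries this to \<open>p\<close> itself.\<close>

lemma symmetric_second_derivative_real:
  fixes F :: "'a::real_normed_vector \<Rightarrow> real"
  assumes S: "open S" "p \<in> S"
    and F: "\<And>x. x \<in> S \<Longrightarrow> (F has_derivative F' x) (at x)"
    and Fu: "\<And>x. x \<in> S \<Longrightarrow> ((\<lambda>y. F' y u) has_derivative Fu x) (at x)"
    and Fv: "\<And>x. x \<in> S \<Longrightarrow> ((\<lambda>y. F' y v) has_derivative Fv x) (at x)"
    and cont: "continuous (at p) (\<lambda>x. Fu x v)" "continuous (at p) (\<lambda>x. Fv x u)"
  shows "Fu p v = Fv p u"
proof (rule ccontr)
  assume ne: "Fu p v \<noteq> Fv p u"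
  \<comment> \<open>Half the supposed gap: a common value cannot be closer than \<open>e\<close> to
    both \<open>Fu p v\<close> and \<open>Fv p u\<close>.\<close>
  define e where "e = \<bar>Fu p v - Fv p u\<bar> / 2"
  have "e > 0" using ne by (simp add: e_def)
  have e2: "2 * e = \<bar>Fu p v - Fv p u\<bar>" by (simp add: e_def)
  obtain r0 where r0: "r0 > 0" "ball p r0 \<subseteq> S" using S open_contains_ball by blast
  obtain r1 where r1: "r1 > 0" "\<And>x. dist x p < r1 \<Longrightarrow> dist (Fu x v) (Fu p v) < e"
    using cont(1) \<open>e > 0\<close> unfolding continuous_at_eps_delta by blast
  obtain r2 where r2: "r2 > 0" "\<And>x. dist x p < r2 \<Longrightarrow> dist (Fv x u) (Fv p u) < e"
    using cont(2) \<open>e > 0\<close> unfolding continuous_at_eps_delta by blast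
  define r where "r = min r0 (min r1 r2)"
  have r: "r > 0" "ball p r \<subseteq> S" using r0 r1 r2 by (auto simp: r_def)
  \<comment> \<open>The added 1 avoids division by zero and makes the bound \<open>hr\<close>
    strict.\<close>
  define h where "h = r / (norm u + norm v + 1)"
  have pos: "norm u + norm v + 1 > 0" using norm_ge_zero[of u] norm_ge_zero[of v] by linarith
  have h: "h > 0" using r pos by (simp add: h_def)
  have hr: "h * (norm u + norm v) < r"
    using r pos by (simp add: h_def field_simps)
  obtain \<xi> where \<xi>: "\<xi> \<in> ball p r"
    "F (p + h *\<^sub>R u + h *\<^sub>R v) - F (p + h *\<^sub>R u) - F (p + h *\<^sub>R v) + F p = h\<^sup>2 * Fu \<xi> v"
    using second_difference_mean_value[of p r F F' u Fu h v] F Fu r(2) h hr by blast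
  obtain \<eta> where \<eta>: "\<eta> \<in> ball p r"
    "F (p + h *\<^sub>R v + h *\<^sub>R u) - F (p + h *\<^sub>R v) - F (p + h *\<^sub>R u) + F p = h\<^sup>2 * Fv \<eta> u"
    using second_difference_mean_value[of p r F F' v Fv h u] F Fv r(2) h hr
    by (metis add.commute subsetD)
  have swap: "p + h *\<^sub>R v + h *\<^sub>R u = p + h *\<^sub>R u + h *\<^sub>R v" by simp
  have "h\<^sup>2 * Fu \<xi> v = h\<^sup>2 * Fv \<eta> u" using \<xi>(2) \<eta>(2)[unfolded swap] by linarith
  then have "Fu \<xi> v = Fv \<eta> u" using h by simp
  moreover have "dist (Fu \<xi> v) (Fu p v) < e" "dist (Fv \<eta> u) (Fv p u) < e"
    using \<xi>(1) \<eta>(1) r1(2) r2(2) by (auto simp: r_def dist_commute)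
  ultimately show False using e2 unfolding dist_real_def by linarith
qed

lemma smooth_on_has_derivative:
  assumes "smooth_on S f" "x \<in> S"
  shows "(f has_derivative frechet_derivative f (at x)) (at x)"
proof -
  have "times_differentiable_on (Suc 0) f S" using assms(1) unfolding smooth_on_def by blast
  then show ?thesis using assms(2) frechet_derivative_works by auto
qed

lemma smooth_on_frechet_derivative:
  assumes "smooth_on S f"
  shows "smooth_on S (\<lambda>x. frechet_derivative f (at x) v)"
  using assms unfolding smooth_on_def by (metis times_differentiable_on.simps(2))

lemma smooth_on_continuous_at:
  assumes "smooth_on S f" "x \<in> S"
  shows "continuous (at x) f"
  using has_derivative_continuous[OF smooth_on_has_derivative[OF assms]] .

text \<open>Pairing with each basis vector \<open>b\<close> reduces this to the real-valued
  case.\<close>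

lemma symmetric_second_derivative:
  fixes \<phi> :: "'a::euclidean_space \<Rightarrow> 'b::euclidean_space"
  assumes S: "open S" "p \<in> S" and \<phi>: "smooth_on S \<phi>"
  shows "frechet_derivative (\<lambda>x. frechet_derivative \<phi> (at x) u) (at p) v =
    frechet_derivative (\<lambda>x. frechet_derivative \<phi> (at x) v) (at p) u"
proof (rule euclidean_eqI)
  fix b :: 'b
  note sm = smooth_on_frechet_derivative[OF \<phi>]
  note der = smooth_on_has_derivative[OF sm]
  note cont = smooth_on_continuous_at[OF smooth_on_frechet_derivative[OF sm] S(2)]
  show "frechet_derivative (\<lambda>x. frechet_derivative \<phi> (at x) u) (at p) v \<bullet> b =
    frechet_derivative (\<lambda>x. frechet_derivative \<phi> (at x) v) (at p) u \<bullet> b"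
    by (rule symmetric_second_derivative_real[OF S, of "\<lambda>x. \<phi> x \<bullet> b"
          "\<lambda>x k. frechet_derivative \<phi> (at x) k \<bullet> b" u
          "\<lambda>x k. frechet_derivative (\<lambda>x. frechet_derivative \<phi> (at x) u) (at x) k \<bullet> b" v
          "\<lambda>x k. frechet_derivative (\<lambda>x. frechet_derivative \<phi> (at x) v) (at x) k \<bullet> b"])
      (auto intro!: has_derivative_inner_left smooth_on_has_derivative[OF \<phi>] der
        continuous_intros cont)
qed

section \<open>The coordinate 3-forms\<close>

lemma exhaust_6: "(i::6) = 1 \<or> i = 2 \<or> i = 3 \<or> i = 4 \<or> i = 5 \<or> i = 6"
proof (induct i)
  case (of_int z)
  \<comment> \<open>The representatives are 0 to 5, and 0 is the index 6.\<close>
  then have "z = 0 \<or> z = 1 \<or> z = 2 \<or> z = 3 \<or> z = 4 \<or> z = 5" by simp arith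
  then show ?case by auto
qed

lemma forall_6: "(\<forall>i::6. P i) \<longleftrightarrow> P 1 \<and> P 2 \<and> P 3 \<and> P 4 \<and> P 5 \<and> P 6"
  by (metis exhaust_6)

lemma wedge_1_1:
  "wedge 1 1 \<alpha> \<beta> vs =
    (if length vs = 2 then \<alpha> [vs ! 0] * \<beta> [vs ! 1] - \<alpha> [vs ! 1] * \<beta> [vs ! 0] else 0)"
proof -
  have s: "{..<1 + 1::nat} = {0, 1}" by auto
  have f: "finite {1::nat}" "0 \<notin> {1::nat}" by auto
  show ?thesis
    unfolding wedge_def s sum_over_permutations_insert[OF f] permutes_sing
    by (auto simp: permute_list_def numeral_2_eq_2 sign_swap_id)
qed

lemma dx3_eq_0: "length vs \<noteq> 3 \<Longrightarrow> dx3 i j k vs = 0"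
  by (simp add: dx3_def wedge_def)

text \<open>The right-hand side is the expanded 3 by 3 determinant of components. It turns later
  claims about the forms into polynomial identities.\<close>

lemma dx3_eq:
  "dx3 i j k [a, b, c] = a $ i * b $ j * c $ k - a $ i * b $ k * c $ j - a $ j * b $ i * c $ k
    + a $ j * b $ k * c $ i + a $ k * b $ i * c $ j - a $ k * b $ j * c $ i"
proof -
  have s: "{..<1 + 2::nat} = {0, 1, 2}" by auto
  have f: "finite {1::nat, 2}" "0 \<notin> {1::nat, 2}" "finite {2::nat}" "1 \<notin> {2::nat}" by auto
  have perm: "permutation (Transposition.transpose a (b::nat))" for a b by (rule permutation_swap_id)
  show ?thesis
    \<comment> \<open>Splitting off the points 0 and 1 in turn leaves the permutations of
      \<open>{2}\<close>, that is, the identity.\<close>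
    unfolding dx3_def wedge_def[of 1 2] s sum_over_permutations_insert[OF f(1,2)]
      sum_over_permutations_insert[OF f(3,4)] permutes_sing wedge_1_1
    by (simp add: permute_list_def dx_def sign_swap_id sign_compose perm
        permutation_compose Transposition.transpose_def upt_rec numeral_eq_Suc algebra_simps)
      (simp add: field_simps)
qed

lemma length_3_cases:
  assumes "length vs = 3"
  obtains a b c where "vs = [a, b, c]"
  using assms by (auto simp: numeral_3_eq_3 length_Suc_conv)

lemma dx3_alt_forms: "dx3 i j k \<in> alt_forms 3"
proof -
  have "linear (\<lambda>v. dx3 i j k (vs[m := v]))" if vs: "length vs = 3" "m < 3" for vs m
  proof -
    have "m = 0 \<or> m = 1 \<or> m = 2" using vs by auto
    moreover obtain a b c where "vs = [a, b, c]" by (rule length_3_cases[OF vs(1)])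
    ultimately show ?thesis
      by (elim disjE) (auto intro!: linearI simp: dx3_eq algebra_simps)
  qed
  moreover have "dx3 i j k vs = 0" if "length vs = 3" "\<not> distinct vs" for vs
    using that by (auto elim!: length_3_cases simp: dx3_eq algebra_simps)
  ultimately show ?thesis by (simp add: alt_forms_def dx3_eq_0)
qed

lemma alt_forms_add: "\<alpha> \<in> alt_forms k \<Longrightarrow> \<beta> \<in> alt_forms k \<Longrightarrow> (\<lambda>vs. \<alpha> vs + \<beta> vs) \<in> alt_forms k"
  by (simp add: alt_forms_def linear_compose_add)

lemma alt_forms_diff: "\<alpha> \<in> alt_forms k \<Longrightarrow> \<beta> \<in> alt_forms k \<Longrightarrow> (\<lambda>vs. \<alpha> vs - \<beta> vs) \<in> alt_forms k"
  by (simp add: alt_forms_def linear_compose_sub)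

lemma alt_forms_scale: "\<alpha> \<in> alt_forms k \<Longrightarrow> (\<lambda>vs. c * \<alpha> vs) \<in> alt_forms k"
  unfolding alt_forms_def using linear_compose_scale_right[where 'a='a and 'b=real and c=c] by auto

lemma omega_f_alt_forms: "omega_f f x \<in> alt_forms 3"
  unfolding omega_f_def
  by (intro alt_forms_add alt_forms_diff alt_forms_scale dx3_alt_forms)

section \<open>The form is multisymplectic of constant linear type\<close>

lemma open_M_pos: "open M_pos"
  unfolding M_pos_def by (intro open_Collect_less continuous_intros)

lemma differential_form_omega_f:
  assumes "smooth_on {0<..} f"
  shows "differential_form M_pos 3 (omega_f f)"
proof -
  have "smooth_on M_pos (\<lambda>x. omega_f f x vs)" for vs
    unfolding smooth_on_def
  proof
    fix n
    have "times_differentiable_on n (\<lambda>x. (dx3 1 3 5 vs - dx3 1 4 6 vs - dx3 2 3 6 vs) +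
        dx3 2 4 5 vs * f (x $ 2)) M_pos"
      using assms open_M_pos
      by (intro times_differentiable_on_affine_comp_component[where T = "{0<..}"])
        (auto simp: M_pos_def smooth_on_def)
    then show "times_differentiable_on n (\<lambda>x. omega_f f x vs) M_pos"
      by (simp add: omega_f_def mult.commute)
  qed
  then show ?thesis by (simp add: differential_form_def omega_f_alt_forms)
qed

section \<open>Closedness and nondegeneracy\<close>

lemma frechet_derivative_omega_f:
  assumes "smooth_on {0<..} f" "x \<in> M_pos"
  shows "frechet_derivative (\<lambda>y. omega_f f y vs) (at x) v =
    dx3 2 4 5 vs * v $ 2 * frechet_derivative f (at (x $ 2)) 1"
proof -
  have "f differentiable (at (x $ 2))"
    using smooth_on_has_derivative[OF assms(1), of "x $ 2"] assms(2)
    by (auto simp: M_pos_def differentiable_def)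
  note der = has_derivative_affine_comp_component[OF this,
      of "dx3 1 3 5 vs - dx3 1 4 6 vs - dx3 2 3 6 vs" "dx3 2 4 5 vs"]
  have "(\<lambda>y. omega_f f y vs) =
      (\<lambda>x. (dx3 1 3 5 vs - dx3 1 4 6 vs - dx3 2 3 6 vs) + dx3 2 4 5 vs * f (x $ 2))"
    by (simp add: omega_f_def mult.commute)
  with frechet_derivative_at[OF der] show ?thesis by metis
qed

text \<open>Only the coefficient of \<open>dx3 2 4 5\<close> varies, and only with
  \<open>x $ 2\<close>, so the exterior derivative is a multiple of the wedge product of
  \<open>dx 2\<close> with \<open>dx3 2 4 5\<close>, where \<open>dx 2\<close> occurs twice.\<close>

lemma closed_form_omega_f:
  assumes "smooth_on {0<..} f"
  shows "closed_form M_pos (omega_f f)"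
proof -
  have "exterior_derivative (omega_f f) x vs = 0" if x: "x \<in> M_pos" for x vs
  proof (cases "length vs = 4")
    case True
    then obtain a b c d where "vs = [a, b, c, d]"
      by (auto simp: numeral_eq_Suc length_Suc_conv)
    then show ?thesis
      by (simp add: exterior_derivative_def frechet_derivative_omega_f[OF assms x] numeral_eq_Suc
          dx3_eq algebra_simps)
  next
    case False
    then have "length (take i vs @ drop (Suc i) vs) \<noteq> 3" if "i < length vs" for i
      using that by auto
    then show ?thesis
      by (simp add: exterior_derivative_def frechet_derivative_omega_f[OF assms x] dx3_eq_0)
  qed
  then show ?thesis by (auto simp: closed_form_def)
qed

lemma inj_interior_product_omega_f: "inj (\<lambda>v. interior_product v (omega_f f x))"
proof (rule injI)
  fix v w assume eq: "interior_product v (omega_f f x) = interior_product w (omega_f f x)"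
  have "omega_f f x [v, axis i 1, axis j 1] = omega_f f x [w, axis i 1, axis j 1]" for i j
    using fun_cong[OF eq, of "[axis i 1, axis j 1]"] by (simp add: interior_product_def)
  \<comment> \<open>In this order the pairs yield components 1 to 6 of \<open>v\<close> and
    \<open>w\<close>, up to sign; none of them meets the coefficient \<open>f\<close>.\<close>
  from this[of 3 5] this[of 3 6] this[of 1 5] this[of 1 6] this[of 1 3] this[of 1 4]
  show "v = w"
    by (simp add: omega_f_def dx3_eq axis_def vec_eq_iff forall_6)
qed

lemma multisymplectic_omega_f:
  assumes "smooth_on {0<..} f"
  shows "multisymplectic M_pos 2 (omega_f f)"
  using assms differential_form_omega_f closed_form_omega_f inj_interior_product_omega_f open_M_pos
  by (simp add: multisymplectic_def)

lemma constant_linear_type_omega_f: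
  assumes f_pos: "\<And>t. t > 0 \<Longrightarrow> f t > 0"
  shows "constant_linear_type M_pos (omega_f f)"
  unfolding constant_linear_type_def
proof (intro ballI)
  fix p q assume "p \<in> M_pos" "q \<in> M_pos"
  then have pos: "f (p $ 2) > 0" "f (q $ 2) > 0" using f_pos by (auto simp: M_pos_def)
  \<comment> \<open>Scaling \<open>dx 2\<close> and \<open>dx 4\<close> by \<open>r\<close> and
    \<open>dx 6\<close> by \<open>1 / r\<close> fixes the first three terms of the form and
    multiplies \<open>dx3 2 4 5\<close> by \<open>r * r\<close>, which turns
    \<open>f (q $ 2)\<close> into \<open>f (p $ 2)\<close>.\<close>
  define r where "r = sqrt (f (p $ 2) / f (q $ 2))"
  have r: "r > 0" "f (q $ 2) * (r * r) = f (p $ 2)" using pos by (auto simp: r_def)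
  define s :: "6 \<Rightarrow> real" where "s i = (if i = 2 \<or> i = 4 then r else if i = 6 then inverse r else 1)" for i
  define L :: "real ^ 6 \<Rightarrow> real ^ 6" where "L v = (\<chi> i. s i * v $ i)" for v
  have s0: "s i \<noteq> 0" for i using r by (simp add: s_def)
  have "linear L" by (rule linearI) (auto simp: L_def vec_eq_iff algebra_simps)
  moreover have "bij L"
    by (rule o_bij[of "\<lambda>v. \<chi> i. v $ i / s i"]) (auto simp: L_def vec_eq_iff s0)
  moreover have "pullback_linear L (omega_f f q) = omega_f f p"
  proof
    fix vs
    have dx3_L: "dx3 i j k (map L vs) = s i * s j * s k * dx3 i j k vs" for i j k
    proof (cases "length vs = 3")
      case True
      then show ?thesis by (auto elim!: length_3_cases simp: dx3_eq L_def algebra_simps)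
    qed (simp add: dx3_eq_0)
    have "f (q $ 2) * (s 2 * s 4 * s 5) = f (p $ 2)" using r(2) by (simp add: s_def)
    then have "f (q $ 2) * (s 2 * s 4 * s 5 * X) = f (p $ 2) * X" for X by (metis mult.assoc)
    moreover have "s 1 * s 3 * s 5 = 1" "s 1 * s 4 * s 6 = 1" "s 2 * s 3 * s 6 = 1"
      using r(1) by (simp_all add: s_def)
    ultimately show "pullback_linear L (omega_f f q) vs = omega_f f p vs"
      by (simp add: pullback_linear_def omega_f_def dx3_L)
  qed
  ultimately show "\<exists>L. linear L \<and> bij L \<and> pullback_linear L (omega_f f q) = omega_f f p" by blast
qed

section \<open>Vectors with decomposable contraction\<close>

text \<open>For an alternating \<open>\<beta>\<close> these are the Pluecker relations, i.e. \<open>\<beta>\<close> is a product of two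
  covectors.\<close>

definition decomposable :: "('a list \<Rightarrow> real) \<Rightarrow> bool" where
  "decomposable \<beta> \<longleftrightarrow>
    (\<forall>a b c d. \<beta> [a, b] * \<beta> [c, d] - \<beta> [a, c] * \<beta> [b, d] + \<beta> [a, d] * \<beta> [b, c] = 0)"

lemma decomposableI:
  assumes "\<And>a b. \<beta> [a, b] = P a * Q b - P b * Q a"
  shows "decomposable \<beta>"
  unfolding decomposable_def assms by (simp add: algebra_simps)

text \<open>The Pluecker relations are tested on all vectors, and surjectivity makes each of them an
  image under \<open>L\<close>. Applied to the derivative of a multisymplectic
  diffeomorphism.\<close>

lemma decomposable_pullback_linear:
  assumes "surj L" "pullback_linear L \<alpha> = \<alpha>'"
  shows "decomposable (interior_product (L u) \<alpha>) \<longleftrightarrow> decomposable (interior_product u \<alpha>')"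
proof -
  have eq: "interior_product u \<alpha>' [a, b] = interior_product (L u) \<alpha> [L a, L b]" for a b
    unfolding assms(2)[symmetric] by (simp add: interior_product_def pullback_linear_def)
  show ?thesis
  proof
    assume "decomposable (interior_product u \<alpha>')"
    note * = this[unfolded decomposable_def eq]
    show "decomposable (interior_product (L u) \<alpha>)"
      unfolding decomposable_def
    proof (intro allI)
      fix a b c d
      obtain a' b' c' d' where "a = L a'" "b = L b'" "c = L c'" "d = L d'"
        using assms(1) by (metis surjD)
      with * show "interior_product (L u) \<alpha> [a, b] * interior_product (L u) \<alpha> [c, d]
          - interior_product (L u) \<alpha> [a, c] * interior_product (L u) \<alpha> [b, d]
          + interior_product (L u) \<alpha> [a, d] * interior_product (L u) \<alpha> [b, c] = 0" by simp
    qed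
  qed (simp add: decomposable_def eq)
qed

text \<open>Pluecker relations on basis vectors. If \<open>f (x $ 2) = g * g\<close>, they give (v1
  - g v2)(v3 + g v4) = 0 and (v3 - g v4)(v3 + g v4) = 0: a vector outside the kernel of e1-e2 or of
  e3-e4 lies in that of e3+e4.\<close>

lemma decomposable_omega_f_relations:
  assumes "decomposable (interior_product v (omega_f f x))"
  shows "v $ 1 * v $ 3 = f (x $ 2) * (v $ 2 * v $ 4)"
    and "v $ 1 * v $ 4 = v $ 2 * v $ 3"
    and "v $ 3 * v $ 3 = f (x $ 2) * (v $ 4 * v $ 4)"
proof -
  let ?b = "\<lambda>i j. interior_product v (omega_f f x) [axis i 1, axis j 1]"
  have *: "?b i j * ?b k l - ?b i k * ?b j l + ?b i l * ?b j k = 0" for i j k l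
    using assms unfolding decomposable_def by blast
  show "v $ 1 * v $ 3 = f (x $ 2) * (v $ 2 * v $ 4)"
    using *[of 2 3 5 6] by (simp add: interior_product_def omega_f_def dx3_eq axis_def algebra_simps)
  show "v $ 1 * v $ 4 = v $ 2 * v $ 3"
    using *[of 1 3 5 6] by (simp add: interior_product_def omega_f_def dx3_eq axis_def algebra_simps)
  show "v $ 3 * v $ 3 = f (x $ 2) * (v $ 4 * v $ 4)"
    using *[of 1 2 5 6] by (simp add: interior_product_def omega_f_def dx3_eq axis_def algebra_simps)
qed

text \<open>Both vectors lie in E, so contraction kills the first summand of the form and leaves a
  multiple of (e3-e4)(e5+e6), respectively (e1-e2)(e5+e6). The factor \<open>g\<close> is absorbed
  into e5+e6 to clear the denominator of e6.\<close>

lemma decomposable_omega_f_examples: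
  assumes g: "f (x $ 2) = g * g"
  shows "decomposable (interior_product (axis 2 1 - g *\<^sub>R axis 1 1) (omega_f f x))"
    and "decomposable (interior_product (axis 4 1 - g *\<^sub>R axis 3 1) (omega_f f x))"
proof -
  show "decomposable (interior_product (axis 2 1 - g *\<^sub>R axis 1 1) (omega_f f x))"
    by (rule decomposableI[of _ "\<lambda>a. g * a $ 4 - a $ 3" "\<lambda>a. g * a $ 5 + a $ 6"])
      (simp add: interior_product_def omega_f_def dx3_eq axis_def g algebra_simps)
  show "decomposable (interior_product (axis 4 1 - g *\<^sub>R axis 3 1) (omega_f f x))"
    by (rule decomposableI[of _ "\<lambda>a. a $ 1 - g * a $ 2" "\<lambda>a. g * a $ 5 + a $ 6"])
      (simp add: interior_product_def omega_f_def dx3_eq axis_def g algebra_simps)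
qed

section \<open>Multisymplectic diffeomorphisms\<close>

text \<open>Vectors with equal image under the derivative have equal contraction with the pulled
  back form, which is \<open>\<omega> x\<close>; nondegeneracy makes them equal. In finite dimension
  injectivity gives surjectivity.\<close>

lemma multisymplectic_diffeomorphism_surj_derivative:
  assumes \<phi>: "\<phi> \<in> multisymplectic_diffeomorphisms M \<omega>" and \<omega>: "multisymplectic M k \<omega>" and x: "x \<in> M"
  shows "surj (frechet_derivative \<phi> (at x))"
proof -
  define D where "D = frechet_derivative \<phi> (at x)"
  have "smooth_on M \<phi>" and pb: "pullback_linear D (\<omega> (\<phi> x)) = \<omega> x"
    using \<phi> x by (auto simp: multisymplectic_diffeomorphisms_def diffeomorphisms_def pullback_def D_def)
  then have lin: "linear D"
    unfolding D_def using has_derivative_linear smooth_on_has_derivative x by blast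
  have "inj D"
  proof (rule injI)
    fix u v assume "D u = D v"
    then have "interior_product u (\<omega> x) = interior_product v (\<omega> x)"
      by (auto simp: interior_product_def pullback_linear_def simp flip: pb)
    then show "u = v" using \<omega> x by (auto simp: multisymplectic_def inj_def)
  qed
  then show ?thesis using linear_injective_imp_surjective[OF lin] by (simp add: D_def)
qed

text \<open>Involutivity enters through symmetric second derivatives: the equation e3+e4 = 0 is
  differentiated along the images of two constant vector fields \<open>u\<close> and
  \<open>v\<close>.\<close>

lemma no_multisymplectic_diffeomorphism:
  fixes f :: "real \<Rightarrow> real"
  assumes f_smooth: "smooth_on {0<..} f"
    and f_one: "\<And>t. t \<in> {0<..1} \<Longrightarrow> f t = 1"
    and f_id: "\<And>t. t \<ge> 2 \<Longrightarrow> f t = t"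
    and \<phi>: "\<phi> \<in> multisymplectic_diffeomorphisms M_pos (omega_f f)"
    and p: "0 < p $ 2" "p $ 2 < 1"
  shows "\<phi> p $ 2 \<le> 2"
proof (rule ccontr)
  assume "\<not> \<phi> p $ 2 \<le> 2"
  then have q: "\<phi> p $ 2 > 2" by simp
  define D where "D x = frechet_derivative \<phi> (at x)" for x
  \<comment> \<open>Where \<open>\<phi> x $ 2 \<ge> 2\<close>, this is the coframe factor g at the
    image point, because \<open>f\<close> is the identity there.\<close>
  define g where "g x = sqrt (\<phi> x $ 2)" for x
  have pM: "p \<in> M_pos" using p by (simp add: M_pos_def)
  have sm: "smooth_on M_pos \<phi>"
    using \<phi> by (simp add: multisymplectic_diffeomorphisms_def diffeomorphisms_def)
  have surj: "surj (D x)" if "x \<in> M_pos" for x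
    using multisymplectic_diffeomorphism_surj_derivative[OF \<phi> multisymplectic_omega_f that] f_smooth
    by (simp add: D_def)
  have pb: "pullback_linear (D x) (omega_f f (\<phi> x)) = omega_f f x" if "x \<in> M_pos" for x
    using \<phi> that by (simp add: multisymplectic_diffeomorphisms_def pullback_def D_def)
  have dec: "decomposable (interior_product (D x u) (omega_f f (\<phi> x))) \<longleftrightarrow>
      decomposable (interior_product u (omega_f f x))" if "x \<in> M_pos" for x u
    using decomposable_pullback_linear[OF surj pb] that by blast
  have D\<phi>: "(\<phi> has_derivative D p) (at p)"
    unfolding D_def by (rule smooth_on_has_derivative[OF sm pM])
  have smD: "smooth_on M_pos (\<lambda>x. D x u)" for u
    unfolding D_def by (rule smooth_on_frechet_derivative[OF sm])
  define D2 where "D2 u = frechet_derivative (\<lambda>x. D x u) (at p)" for u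
  have DD: "((\<lambda>x. D x u) has_derivative D2 u) (at p)" for u
    unfolding D2_def by (rule smooth_on_has_derivative[OF smD pM])
  have D2_sym: "D2 u v = D2 v u" for u v
    unfolding D2_def D_def by (rule symmetric_second_derivative[OF open_M_pos pM sm])

  \<comment> \<open>Preimages of two vectors of E at \<open>\<phi> p\<close>. As the form is
    constant where \<open>f\<close> is 1, their contractions stay decomposable at all points near
    \<open>p\<close>.\<close>
  obtain u where u: "D p u = axis 2 1 - g p *\<^sub>R axis 1 1" using surj[OF pM] by (metis surjD)
  obtain v where v: "D p v = axis 4 1 - g p *\<^sub>R axis 3 1" using surj[OF pM] by (metis surjD)
  have gp: "f (\<phi> p $ 2) = g p * g p" "g p > 0" using q f_id by (auto simp: g_def)
  have dec_p: "decomposable (interior_product u (omega_f f p))" "decomposable (interior_product v (omega_f f p))"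
    using decomposable_omega_f_examples[of f "\<phi> p" "g p", OF gp(1)]
    by (simp_all only: u v flip: dec[OF pM])

  have c\<phi>: "continuous (at p) \<phi>" by (rule smooth_on_continuous_at[OF sm pM])
  have cD: "continuous (at p) (\<lambda>x. D x w)" for w by (rule smooth_on_continuous_at[OF smD pM])
  have lim\<phi>: "((\<lambda>x. \<phi> x $ i) \<longlongrightarrow> \<phi> p $ i) (nhds p)" for i
    using c\<phi> by (intro tendsto_vec_nth) (simp add: continuous_at tendsto_nhds_iff)
  have limD: "((\<lambda>x. D x w $ i) \<longlongrightarrow> D p w $ i) (nhds p)" for w i
    using cD[of w] by (intro tendsto_vec_nth) (simp add: continuous_at tendsto_nhds_iff)
  have limp: "((\<lambda>x. x $ i) \<longlongrightarrow> p $ i) (nhds p)" for i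
    by (intro tendsto_vec_nth filterlim_ident)
  have limg: "(g \<longlongrightarrow> g p) (nhds p)"
    unfolding g_def by (intro tendsto_intros lim\<phi>)
  \<comment> \<open>Here e1-e2 on \<open>D p u\<close> and e3-e4 on \<open>D p v\<close> both equal
    \<open>- 2 * g p\<close>. By continuity they stay negative nearby, which keeps the images out of
    F.\<close>
  have ne: "D p u $ 1 - g p * D p u $ 2 < 0" "D p v $ 3 - g p * D p v $ 4 < 0"
    using gp by (simp_all add: u v axis_def)
  have ev: "\<forall>\<^sub>F x in nhds p. 0 < x $ 2 \<and> x $ 2 < 1 \<and> 2 < \<phi> x $ 2 \<and>
      D x u $ 1 - g x * D x u $ 2 < 0 \<and> D x v $ 3 - g x * D x v $ 4 < 0"
    using order_tendstoD(1)[OF limp p(1)] order_tendstoD(2)[OF limp p(2)] order_tendstoD(1)[OF lim\<phi> q]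
      order_tendstoD(2)[OF tendsto_diff[OF limD tendsto_mult[OF limg limD]] ne(1)]
      order_tendstoD(2)[OF tendsto_diff[OF limD tendsto_mult[OF limg limD]] ne(2)]
    by eventually_elim auto
  have zero: "D x u $ 3 + g x * D x u $ 4 = 0" "D x v $ 3 + g x * D x v $ 4 = 0"
    if "0 < x $ 2 \<and> x $ 2 < 1 \<and> 2 < \<phi> x $ 2 \<and>
      D x u $ 1 - g x * D x u $ 2 < 0 \<and> D x v $ 3 - g x * D x v $ 4 < 0" for x
  proof -
    have "omega_f f x = omega_f f p" using that p f_one by (simp add: omega_f_def)
    moreover have "x \<in> M_pos" using that by (simp add: M_pos_def)
    ultimately have "decomposable (interior_product (D x u) (omega_f f (\<phi> x)))"
      "decomposable (interior_product (D x v) (omega_f f (\<phi> x)))"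
      using dec dec_p by auto
    \<comment> \<open>Each relation contributes a fact about \<open>u\<close> and then one about
      \<open>v\<close>.\<close>
    note rel = this[THEN decomposable_omega_f_relations(1)] this[THEN decomposable_omega_f_relations(2)]
      this[THEN decomposable_omega_f_relations(3)]
    have gx: "f (\<phi> x $ 2) = g x * g x" using that f_id by (auto simp: g_def)
    have "(D x u $ 1 - g x * D x u $ 2) * (D x u $ 3 + g x * D x u $ 4) = 0"
      using rel(1,3) unfolding gx by (simp add: algebra_simps)
    then show "D x u $ 3 + g x * D x u $ 4 = 0" using that by auto
    have "(D x v $ 3 - g x * D x v $ 4) * (D x v $ 3 + g x * D x v $ 4) = 0"
      using rel(6) unfolding gx by (simp add: algebra_simps)
    then show "D x v $ 3 + g x * D x v $ 4 = 0" using that by auto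
  qed

  \<comment> \<open>The derivative of the square root at \<open>\<phi> p $ 2\<close>.\<close>
  define c where "c = inverse (g p) / 2"
  have "c > 0" using gp by (simp add: c_def)
  have Dg: "(g has_derivative (\<lambda>k. D p k $ 2 * c)) (at p)"
    unfolding g_def c_def using q
    by (auto intro!: derivative_eq_intros bounded_linear.has_derivative[OF bounded_linear_vec_nth D\<phi>]
        simp: field_simps)
  txt \<open>This is \<open>d (e\<^sub>3 + e\<^sub>4) = 0\<close> on the plane spanned by \<open>D p u\<close> and \<open>D p v\<close>: the second derivatives
    of \<open>\<phi>\<close> cancel by symmetry, leaving the derivative \<open>c\<close> of the square root.\<close>
  have key: "D2 w k $ 3 + (g p * D2 w k $ 4 + D p k $ 2 * c * D p w $ 4) = 0"
    if "\<forall>\<^sub>F x in nhds p. D x w $ 3 + g x * D x w $ 4 = 0" for w k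
  proof -
    have "((\<lambda>x. D x w $ 3 + g x * D x w $ 4) has_derivative
        (\<lambda>k. D2 w k $ 3 + (g p * D2 w k $ 4 + D p k $ 2 * c * D p w $ 4))) (at p)"
      by (intro has_derivative_add has_derivative_mult Dg
          bounded_linear.has_derivative[OF bounded_linear_vec_nth DD])
    moreover have "((\<lambda>x. D x w $ 3 + g x * D x w $ 4) has_derivative (\<lambda>k. 0)) (at p)"
    proof (rule has_derivative_transform_eventually[OF has_derivative_const])
      show "\<forall>\<^sub>F x in at p. 0 = D x w $ 3 + g x * D x w $ 4"
        using that by (auto simp: eventually_at_filter elim: eventually_mono)
      show "0 = D p w $ 3 + g p * D p w $ 4"
        using eventually_nhds_x_imp_x[OF that] by simp
    qed simp
    ultimately show ?thesis by (blast dest: has_derivative_unique fun_cong[of _ _ k])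
  qed
  \<comment> \<open>The term with \<open>c\<close> drops out here since
    \<open>D p v $ 2 = 0\<close>. With the roles exchanged it survives, since
    \<open>D p u $ 2\<close> and \<open>D p v $ 4\<close> are both 1.\<close>
  have "D2 u v $ 3 + g p * D2 u v $ 4 = 0"
    using key[of u v] eventually_mono[OF ev zero(1)] by (simp add: u v axis_def)
  moreover have "D2 v u $ 3 + (g p * D2 v u $ 4 + c) = 0"
    using key[of v u] eventually_mono[OF ev zero(2)] by (simp add: u v axis_def)
  ultimately show False using D2_sym[of u v] \<open>c > 0\<close> by simp
qed

theorem proposition5p19:
  fixes f :: "real \<Rightarrow> real"
  assumes f_pos: "\<And>t. t > 0 \<Longrightarrow> f t > 0"
    and f_smooth: "smooth_on {0<..} f"
    and f_one: "\<And>t. t \<in> {0<..1} \<Longrightarrow> f t = 1"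
    and f_id: "\<And>t. t \<ge> 2 \<Longrightarrow> f t = t"
  shows "multisymplectic M_pos 2 (omega_f f) \<and>
    constant_linear_type M_pos (omega_f f) \<and>
    \<not> acts_transitively_on (multisymplectic_diffeomorphisms M_pos (omega_f f)) M_pos"
proof (intro conjI notI)
  show "multisymplectic M_pos 2 (omega_f f)" by (rule multisymplectic_omega_f[OF f_smooth])
  show "constant_linear_type M_pos (omega_f f)" by (rule constant_linear_type_omega_f[OF f_pos])
  assume "acts_transitively_on (multisymplectic_diffeomorphisms M_pos (omega_f f)) M_pos"
  \<comment> \<open>Sample points whose second coordinates are below 1 and above 2.\<close>
  moreover have "(\<chi> i. 1 / 2) \<in> M_pos" "(\<chi> i. 3) \<in> M_pos" by (auto simp: M_pos_def)
  ultimately obtain \<phi> where "\<phi> \<in> multisymplectic_diffeomorphisms M_pos (omega_f f)"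
    "\<phi> (\<chi> i. 1 / 2) = (\<chi> i. 3)"
    unfolding acts_transitively_on_def by blast
  then show False
    using no_multisymplectic_diffeomorphism[OF f_smooth f_one f_id, of \<phi> "\<chi> i. 1 / 2"] by simp
qed

end
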